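(* Let $X\subset\{0,1\}^{\mathbb{N}}$ be the shift space $X=\overline{\bigcup_{n\ge0}X_n}$ defined in the context. Then $(X,\sigma)$ is topologically mixing, i.e. for any nonempty open sets $U,V\subset X$ there is $N\in\mathbb{N}$ such that $\sigma^{-n}(V)\cap U\ne\emptyset$ for all $n\ge N$.
   Context: $\mathbb{N}=\{1,2,\dots\}$; $\{0,1\}^{\mathbb{N}}$ carries the product topology and $\sigma$ is the shift map, $\sigma(x)_i=x_{i+1}$. A shift space is a closed $\sigma$-invariant subset. For blocks, $u^\infty=uuu\dots$, $0^\alpha$ is the block of $\alpha$ zeros ($0^0$ is the empty block), and $\|u\|_1$ is the number of $1$'s in $u$. A block is a from-$1$-to-$1$ word if it equals $1$ or has the form $1v1$ with $v\in\{0,1\}^*$ (possibly empty). For a shift space $Y\subset\{0,1\}^{\mathbb{N}}$, $\mathcal{G}_m(Y)$ is the set of all from-$1$-to-$1$ words $u$ that occur in some point of $Y$ and satisfy $\|u\|_1\le m$. Construction of $X$: let $X_0=\{0^\infty\}\cup\{0^\alpha10^\infty:\alpha\ge0\}$. Given $X_n$ ($n\ge0$), let $$P_{n+1}=\bigcup_{l=0}^\infty\sigma^l\big(\{(u0^k)^\infty:k\ge2^{2n},\ u\in\mathcal{G}_{2^n}(X_n)\}\big),$$ $$J'_{n+1}=\{0^\alpha u0^\infty:\alpha\ge0,\ u\in\mathcal{G}_{2^n}(X_n)\},$$ $$J''_{n+1}=\{0^\alpha u0^\beta v0^\infty:\alpha\ge0,\ \beta\ge2^{2n},\ u,v\in\mathcal{G}_{2^n}(X_n)\},$$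 $J_{n+1}=J'_{n+1}\cup J''_{n+1}$, $Y_{n+1}=\overline{P_{n+1}\cup J_{n+1}}$, and $X_{n+1}=X_n\cup Y_{n+1}$. Finally $X=\overline{\bigcup_{n=0}^\infty X_n}$. *)

theory Defs
  imports "HOL-Analysis.Analysis"
begin

text \<open>
  Points of the full one-sided shift are functions \<^typ>\<open>nat \<Rightarrow> bool\<close>, with True for the symbol 1 and
  False for the symbol 0, so coordinate \<open>i\<close> here is coordinate \<open>i + 1\<close> of the usual indexing by
  \<open>1, 2, \<dots>\<close>. The type class topology on functions is the product topology, and \<^typ>\<open>bool\<close> is discrete.
\<close>

type_synonym binseq = "nat \<Rightarrow> bool"
type_synonym block = "bool list"

definition shift_map :: "binseq \<Rightarrow> binseq" where
  "shift_map x = (\<lambda>i. x (Suc i))"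

abbreviation zeros :: "nat \<Rightarrow> block" where
  "zeros k \<equiv> replicate k False"

text \<open>The point \<open>u\<^sup>\<infinity>\<close>; meaningful only for nonempty \<open>u\<close>.\<close>

definition periodic :: "block \<Rightarrow> binseq" where
  "periodic u = (\<lambda>i. u ! (i mod length u))"

text \<open>The point \<open>u0\<^sup>\<infinity>\<close>; the empty block gives \<open>0\<^sup>\<infinity>\<close>.\<close>

definition zero_tail :: "block \<Rightarrow> binseq" where
  "zero_tail u = (\<lambda>i. if i < length u then u ! i else False)"

definition ones :: "block \<Rightarrow> nat" where
  "ones u = count_list u True"

definition from_1_to_1 :: "block \<Rightarrow> bool" where
  "from_1_to_1 u \<longleftrightarrow> u = [True] \<or> (\<exists>v. u = [True] @ v @ [True])"

definition occurs_in :: "block \<Rightarrow> binseq \<Rightarrow> bool" where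
  "occurs_in u x \<longleftrightarrow> (\<exists>i. \<forall>j<length u. x (i + j) = u ! j)"

definition G :: "nat \<Rightarrow> binseq set \<Rightarrow> block set" where
  "G m Y = {u. from_1_to_1 u \<and> (\<exists>x\<in>Y. occurs_in u x) \<and> ones u \<le> m}"

text \<open>
  The sets below with parameters \<open>n\<close> and \<open>Y\<close> are \<open>P\<^bsub>n+1\<^esub>\<close>, \<open>J'\<^bsub>n+1\<^esub>\<close>, \<open>J''\<^bsub>n+1\<^esub>\<close>, \<open>J\<^bsub>n+1\<^esub>\<close> and
  \<open>Y\<^bsub>n+1\<^esub>\<close> when \<open>Y\<close> is \<open>X\<^bsub>n\<^esub>\<close>.
\<close>

definition P_next :: "nat \<Rightarrow> binseq set \<Rightarrow> binseq set" where
  "P_next n Y =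
    (\<Union>l. (shift_map ^^ l) ` {periodic (u @ zeros k) | u k. k \<ge> 2 ^ (2 * n) \<and> u \<in> G (2 ^ n) Y})"

definition J'_next :: "nat \<Rightarrow> binseq set \<Rightarrow> binseq set" where
  "J'_next n Y = {zero_tail (zeros \<alpha> @ u) | \<alpha> u. u \<in> G (2 ^ n) Y}"

definition J''_next :: "nat \<Rightarrow> binseq set \<Rightarrow> binseq set" where
  "J''_next n Y =
    {zero_tail (zeros \<alpha> @ u @ zeros \<beta> @ v) | \<alpha> u \<beta> v.
       \<beta> \<ge> 2 ^ (2 * n) \<and> u \<in> G (2 ^ n) Y \<and> v \<in> G (2 ^ n) Y}"

definition J_next :: "nat \<Rightarrow> binseq set \<Rightarrow> binseq set" where
  "J_next n Y = J'_next n Y \<union> J''_next n Y"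

definition Y_next :: "nat \<Rightarrow> binseq set \<Rightarrow> binseq set" where
  "Y_next n Y = closure (P_next n Y \<union> J_next n Y)"

primrec X_stage :: "nat \<Rightarrow> binseq set" where
  "X_stage 0 = {zero_tail []} \<union> {zero_tail (zeros \<alpha> @ [True]) | \<alpha>. True}"
| "X_stage (Suc n) = X_stage n \<union> Y_next n (X_stage n)"

definition X :: "binseq set" where
  "X = closure (\<Union>n. X_stage n)"

text \<open>Open sets are relatively open in \<open>S\<close>, and preimages are taken in \<open>S\<close>.\<close>

definition topologically_mixing_on :: "'a::topological_space set \<Rightarrow> ('a \<Rightarrow> 'a) \<Rightarrow> bool" where
  "topologically_mixing_on S T \<longleftrightarrow>
    (\<forall>U V. openin (top_of_set S) U \<and> openin (top_of_set S) V \<and> U \<noteq> {} \<and> V \<noteq> {} \<longrightarrow>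
       (\<exists>N\<ge>1. \<forall>n\<ge>N. {x \<in> S. (T ^^ n) x \<in> V} \<inter> U \<noteq> {}))"

end

theory Submission
  imports Defs
begin

text \<open>
  The points \<open>0\<^sup>\<alpha>u0\<^sup>\<infinity>\<close> of the sets \<open>J'\<^bsub>n+1\<^esub>\<close> are dense in \<open>X\<close>: the first \<open>L\<close> symbols of a point
  of \<open>X\<^bsub>n\<^esub>\<close> are \<open>0\<^sup>\<alpha>u0\<^sup>\<gamma>\<close>, where \<open>u\<close> has at most \<open>L\<close> ones, or \<open>0\<^sup>L\<close>, which
  begins \<open>0\<^sup>L10\<^sup>\<infinity>\<close>. If \<open>U\<close> contains the points of \<open>X\<close> close
  to \<open>0\<^sup>\<alpha>u0\<^sup>\<infinity>\<close>, and \<open>V\<close> contains \<open>q = 0\<^sup>\<gamma>v0\<^sup>\<infinity>\<close>, then for every large \<open>m\<close> the point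
  \<open>0\<^sup>\<alpha>u0\<^sup>\<beta>v0\<^sup>\<infinity>\<close> with \<open>\<alpha> + |u| + \<beta> = m + \<gamma>\<close> belongs to \<open>J''\<^bsub>n+1\<^esub>\<close>, lies in \<open>U\<close>, and is sent to \<open>q\<close>
  by \<open>\<sigma>\<^sup>m\<close>.
\<close>

lemma shift_map_funpow: "(shift_map ^^ n) x = (\<lambda>i. x (n + i))"
  by (induction n arbitrary: x) (simp_all add: shift_map_def funpow_swap1)

lemma zero_tail_append_left:
  "i < length u \<Longrightarrow> zero_tail (u @ v) i = zero_tail u i"
  by (simp add: zero_tail_def nth_append)

lemma zero_tail_append_right:
  "zero_tail (u @ v) (length u + i) = zero_tail v i"
  by (simp add: zero_tail_def nth_append)

lemma zero_tail_append_zeros: "zero_tail (u @ zeros k) = zero_tail u"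
  by (auto simp: zero_tail_def nth_append)

text \<open>A basic open set of the product topology restricts only finitely many coordinates, and
  \<open>L\<close> bounds all of them.\<close>

lemma open_contains_cylinder:
  fixes S :: "(nat \<Rightarrow> 'a::topological_space) set"
  assumes "open S" "x \<in> S"
  obtains L where "\<And>z. (\<And>i. i < L \<Longrightarrow> z i = x i) \<Longrightarrow> z \<in> S"
proof -
  have "openin (product_topology (\<lambda>_. euclidean) UNIV) S"
    using assms(1) by (simp add: euclidean_product_topology flip: open_openin)
  from product_topology_open_contains_basis[OF this assms(2)]
  obtain B :: "nat \<Rightarrow> 'a set" where B: "x \<in> Pi\<^sub>E UNIV B" "finite {i. B i \<noteq> UNIV}" "Pi\<^sub>E UNIV B \<subseteq> S"
    by auto
  from B(2) obtain L where L: "\<And>i. B i \<noteq> UNIV \<Longrightarrow> i < L"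
    unfolding finite_nat_set_iff_bounded by blast
  have "z \<in> S" if "\<And>i. i < L \<Longrightarrow> z i = x i" for z
  proof -
    have "z i \<in> B i" for i
      using L[of i] that[of i] B(1) by (cases "B i = UNIV") (auto simp: PiE_iff)
    then show ?thesis using B(3) by (auto simp: PiE_iff)
  qed
  then show ?thesis using that by blast
qed

lemma X_stage_mono: "m \<le> n \<Longrightarrow> X_stage m \<subseteq> X_stage n"
  by (rule lift_Suc_mono_le[of X_stage]) simp_all

lemma X_stage_subset_X: "X_stage n \<subseteq> X"
  unfolding X_def by (rule order_trans[OF UN_upper closure_subset]) simp

lemma G_mono: "m \<le> m' \<Longrightarrow> Y \<subseteq> Y' \<Longrightarrow> G m Y \<subseteq> G m' Y'"
  unfolding G_def by force

lemma G_X_stage_mono: "m \<le> n \<Longrightarrow> G (2 ^ m) (X_stage m) \<subseteq> G (2 ^ n) (X_stage n)"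
  by (intro G_mono X_stage_mono) simp_all

lemma J_next_subset_X: "J_next n (X_stage n) \<subseteq> X"
proof -
  have "J_next n (X_stage n) \<subseteq> X_stage (Suc n)"
    using closure_subset by (fastforce simp: Y_next_def)
  then show ?thesis using X_stage_subset_X by blast
qed

text \<open>Supplies a word for a prefix without ones, from which no from-1-to-1 word can be
  cut.\<close>

lemma single_one_in_G: "[True] \<in> G (2 ^ n) (X_stage n)"
proof -
  have "zero_tail (zeros 0 @ [True]) \<in> X_stage 0"
    by (auto simp del: replicate_0)
  then have "zero_tail [True] \<in> X_stage n"
    using X_stage_mono[of 0 n] by auto
  moreover have "occurs_in [True] (zero_tail [True])"
    by (auto simp: occurs_in_def zero_tail_def)
  ultimately show ?thesis
    by (auto simp: G_def from_1_to_1_def ones_def)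
qed

lemma from_1_to_1_window:
  assumes "x a" "x b" "a \<le> b"
  shows "from_1_to_1 (map x [a..<Suc b])"
proof (cases "a = b")
  case False
  with assms have "map x [a..<Suc b] = [True] @ map x [Suc a..<b] @ [True]"
    by (simp add: upt_conv_Cons)
  then show ?thesis unfolding from_1_to_1_def by blast
qed (use assms in \<open>simp add: from_1_to_1_def\<close>)

lemma prefix_from_1_to_1:
  assumes "x \<in> X_stage n"
  obtains u k \<alpha> where "u \<in> G (2 ^ k) (X_stage k)"
    "\<forall>i<L. zero_tail (zeros \<alpha> @ u) i = x i"
proof (cases "\<exists>i<L. x i")
  case False
  \<comment> \<open>The single 1 sits at index \<open>L\<close>, the first position outside the
    window.\<close>
  have "zero_tail (zeros L @ [True]) i = x i" if "i < L" for i
    using that False by (simp add: zero_tail_def nth_append)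
  then show ?thesis using that[OF single_one_in_G] by blast
next
  case True
  define A where "A = {i. i < L \<and> x i}"
  have A: "finite A" "A \<noteq> {}" using True by (auto simp: A_def)
  define a where "a = Min A"
  define b where "b = Max A"
  have ab: "x a" "x b" "b < L" "a \<le> b"
    using Min_in[OF A] Max_in[OF A] Min_le_iff[OF A] by (auto simp: a_def b_def A_def)
  have outside: "\<not> x i" if "i < L" "i < a \<or> i > b" for i
  proof
    assume "x i"
    then have "i \<in> A" using that by (simp add: A_def)
    then show False
      using that(2) Min_le[OF A(1)] Max_ge[OF A(1)] by (auto simp: a_def b_def simp flip: not_le)
  qed
  define u where "u = map x [a..<Suc b]"
  have "ones u \<le> length u" by (simp add: ones_def count_le_length)
  also have "\<dots> \<le> L" using ab by (simp add: u_def)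
  \<comment> \<open>Stage \<open>n\<close> may allow fewer than \<open>L\<close> ones. Passing to
    stage \<open>n + L\<close> raises the bound above \<open>L\<close>, and \<open>x\<close> is
    still present because the stages increase.\<close>
  also have "\<dots> \<le> 2 ^ (n + L)"
    by (meson le_add2 le_trans less_exp less_imp_le_nat)
  finally have "ones u \<le> 2 ^ (n + L)" .
  moreover have "x \<in> X_stage (n + L)" using assms X_stage_mono[of n "n + L"] by auto
  moreover have "occurs_in u x"
    unfolding occurs_in_def u_def by (intro exI[of _ a]) (auto simp del: upt_Suc)
  moreover have "from_1_to_1 u"
    unfolding u_def using ab by (intro from_1_to_1_window)
  ultimately have "u \<in> G (2 ^ (n + L)) (X_stage (n + L))"
    by (auto simp: G_def)
  moreover have "zero_tail (zeros a @ u) i = x i" if "i < L" for i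
    using that outside[of i] by (auto simp: zero_tail_def nth_append u_def simp del: upt_Suc)
  ultimately show ?thesis using that by blast
qed

text \<open>An open set that meets the closure meets some \<open>X_stage n\<close> itself, so the
  cylinder can be taken around a point of a finite stage, whose prefix comes from a word in
  \<open>G\<close>.\<close>

lemma openin_X_contains_cylinder:
  assumes "openin (top_of_set X) U" "U \<noteq> {}"
  obtains u k L \<alpha> where "u \<in> G (2 ^ k) (X_stage k)"
    "\<forall>z\<in>X. (\<forall>i<L. z i = zero_tail (zeros \<alpha> @ u) i) \<longrightarrow> z \<in> U"
proof -
  obtain S where S: "open S" "U = X \<inter> S"
    using assms(1) by (auto simp: openin_open)
  with assms(2) obtain x where "x \<in> S" "x \<in> closure (\<Union>n. X_stage n)"
    by (auto simp: X_def)
  then obtain y n where y: "y \<in> S" "y \<in> X_stage n"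
    using open_Int_closure_eq_empty[OF S(1)] by blast
  obtain L where L: "\<And>z. (\<And>i. i < L \<Longrightarrow> z i = y i) \<Longrightarrow> z \<in> S"
    using open_contains_cylinder[OF S(1) y(1)] by blast
  obtain u k \<alpha> where u: "u \<in> G (2 ^ k) (X_stage k)"
    "\<forall>i<L. zero_tail (zeros \<alpha> @ u) i = y i"
    by (rule prefix_from_1_to_1[OF y(2), of L])
  show ?thesis
    by (rule that[OF u(1), of L \<alpha>]) (use L u(2) S(2) in auto)
qed

theorem lemma7:
  shows "topologically_mixing_on X shift_map"
  unfolding topologically_mixing_on_def
proof (intro allI impI, elim conjE)
  fix U V
  assume "openin (top_of_set X) U" "U \<noteq> {}"
  then obtain u k L \<alpha> where u: "u \<in> G (2 ^ k) (X_stage k)"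
    and U: "\<forall>z\<in>X. (\<forall>i<L. z i = zero_tail (zeros \<alpha> @ u) i) \<longrightarrow> z \<in> U"
    by (rule openin_X_contains_cylinder)
  assume "openin (top_of_set X) V" "V \<noteq> {}"
  then obtain v l M \<gamma> where v: "v \<in> G (2 ^ l) (X_stage l)"
    and V: "\<forall>z\<in>X. (\<forall>i<M. z i = zero_tail (zeros \<gamma> @ v) i) \<longrightarrow> z \<in> V"
    by (rule openin_X_contains_cylinder)
  define n where "n = max k l"
  have uv: "u \<in> G (2 ^ n) (X_stage n)" "v \<in> G (2 ^ n) (X_stage n)"
    using u v G_X_stage_mono[of k n] G_X_stage_mono[of l n] by (auto simp: n_def)
  define q where "q = zero_tail (zeros \<gamma> @ v)"
  have "q \<in> J_next n (X_stage n)"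
    using uv by (auto simp: q_def J_next_def J'_next_def)
  then have "q \<in> X" using J_next_subset_X by blast
  then have "q \<in> V" using V by (simp add: q_def)
  \<comment> \<open>For \<open>m \<ge> N\<close> the gap \<open>\<delta>\<close> is at least
    \<open>2 ^ (2 * n)\<close>, and \<open>m\<close> exceeds \<open>L\<close>, so the second word
    starts beyond the window that decides membership in \<open>U\<close>.\<close>
  define N where "N = 1 + L + \<alpha> + length u + 2 ^ (2 * n)"
  have "{x \<in> X. (shift_map ^^ m) x \<in> V} \<inter> U \<noteq> {}" if "m \<ge> N" for m
  proof -
    define \<delta> where "\<delta> = m - \<alpha> - length u"
    have \<delta>: "m = \<alpha> + length u + \<delta>" "\<delta> \<ge> 2 ^ (2 * n)"
      using that by (auto simp: \<delta>_def N_def)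
    \<comment> \<open>The block \<open>w\<close> has length exactly \<open>m\<close>, so the
      \<open>m\<close>-th shift removes it and leaves \<open>q\<close>. Its final zeros merge with
      the initial zeros of \<open>q\<close> into one gap of length
      \<open>\<delta> + \<gamma>\<close>.\<close>
    define w where "w = zeros \<alpha> @ u @ zeros \<delta>"
    define z where "z = zero_tail (w @ zeros \<gamma> @ v)"
    have w: "length w = m" using \<delta> by (simp add: w_def)
    have "z = zero_tail (zeros \<alpha> @ u @ zeros (\<delta> + \<gamma>) @ v)"
      by (simp add: z_def w_def replicate_add)
    moreover have "\<delta> + \<gamma> \<ge> 2 ^ (2 * n)" using \<delta>(2) by simp
    ultimately have "z \<in> J_next n (X_stage n)"
      using uv unfolding J_next_def J''_next_def by blast
    then have "z \<in> X" using J_next_subset_X by blast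
    moreover have "(shift_map ^^ m) z = q"
      unfolding shift_map_funpow z_def q_def using zero_tail_append_right[of w] w by simp
    moreover have "z i = zero_tail (zeros \<alpha> @ u) i" if "i < L" for i
    proof -
      have "i < length w" using that \<open>m \<ge> N\<close> w by (simp add: N_def)
      then have "z i = zero_tail w i"
        unfolding z_def by (rule zero_tail_append_left)
      then show ?thesis
        using zero_tail_append_zeros[of "zeros \<alpha> @ u" \<delta>] by (simp add: w_def)
    qed
    then have "z \<in> U" using U \<open>z \<in> X\<close> by blast
    ultimately show ?thesis using \<open>q \<in> V\<close> by auto
  qed
  moreover have "N \<ge> 1" by (simp add: N_def)
  ultimately show "\<exists>N\<ge>1. \<forall>n\<ge>N. {x \<in> X. (shift_map ^^ n) x \<in> V} \<inter> U \<noteq> {}"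
    by blast
qed

end
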